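(* Let $V$ be uniformly distributed in the rectangle $\mathfrak{R}(o)=[-\ell_x/2,\ell_x/2]\times[-\ell_y/2,\ell_y/2]$, with $\ell_x,\ell_y>0$, and let $u=(u_x,u_y)$ be a fixed reference point with $|u_x|<\ell_x/2$ and $|u_y|<\ell_y/2$. Let $\Theta\in[0,2\pi)$ be the azimuth angle of $V$ as seen from $u$, i.e. $V-u=(R\cos\Theta,R\sin\Theta)$ with $R\ge 0$. Then for all $\theta\in[0,2\pi]$ the marginal CDF $F_\Theta(\theta)=\Pr(\Theta\le\theta)$ equals $$F_\Theta(\theta)=\frac{1}{2\ell_x\ell_y}\Big(\sum_{i=1}^{4}h_i^2\,\mathbb F(\tan;\epsilon_{i,1};\epsilon_{i,2}(\theta))-\sum_{i=5}^{8}h_i^2\,\mathbb F(\cot;\epsilon_{i,1};\epsilon_{i,2}(\theta))\Big),$$ where, with $\gamma_1=\arctan(h_{y^+}/h_{x^+})$, $\gamma_2=\arctan(h_{y^+}/h_{x^-})+\pi$, $\gamma_3=\arctan(h_{y^-}/h_{x^-})+\pi$, $\gamma_4=\arctan(h_{y^-}/h_{x^+})+2\pi$, the pairs $(\epsilon_{i,1},\epsilon_{i,2}(\theta))$ for $i=1,\dots,8$ are $$(0,\min(\theta,\gamma_1)),\ (\gamma_4,\theta),\ (\pi,\min(\theta,\gamma_3)),\ (\gamma_2,\min(\theta,\pi)),$$ $$(\gamma_1,\min(\theta,\tfrac{\pi}{2})),\ (\tfrac{\pi}{2},\min(\theta,\gamma_2)),\ (\gamma_3,\min(\theta,\tfrac{3\pi}{2})),\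 (\tfrac{3\pi}{2},\min(\theta,\gamma_4)).$$
   Context: For a real function $f$, $\mathbb F(f;a;b)=f(b)-f(a)$ if $b\ge a$ and $0$ otherwise. $\cot=1/\tan=\cos/\sin$. $h_{x^+}=\frac{\ell_x}{2}-u_x$, $h_{x^-}=-\frac{\ell_x}{2}-u_x$, $h_{y^+}=\frac{\ell_y}{2}-u_y$, $h_{y^-}=-\frac{\ell_y}{2}-u_y$, and $(h_1,\dots,h_8)=(h_{x^+},h_{x^+},-h_{x^-},-h_{x^-},h_{y^+},h_{y^+},-h_{y^-},-h_{y^-})$. *)

theory Defs
  imports "HOL-Probability.Probability"
begin

definition rectangle :: "real \<Rightarrow> real \<Rightarrow> (real \<times> real) set" where
  "rectangle lx ly = {- lx / 2 .. lx / 2} \<times> {- ly / 2 .. ly / 2}"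

definition increment :: "(real \<Rightarrow> real) \<Rightarrow> real \<Rightarrow> real \<Rightarrow> real" where
  "increment f a b = (if a \<le> b then f b - f a else 0)"

(* Signed offsets of the right/left (upper/lower) sides, seen from the reference point:
   l is a side length of the rectangle and u the matching coordinate of the point. *)

definition h_plus :: "real \<Rightarrow> real \<Rightarrow> real" where
  "h_plus l u = l / 2 - u"

definition h_minus :: "real \<Rightarrow> real \<Rightarrow> real" where
  "h_minus l u = - l / 2 - u"

(* The families h and eps below are numbered from 1 to 8, list positions from 0. *)

definition h :: "real \<Rightarrow> real \<Rightarrow> real \<Rightarrow> real \<Rightarrow> nat \<Rightarrow> real" where
  "h lx ly ux uy i =
    [h_plus lx ux, h_plus lx ux, - h_minus lx ux, - h_minus lx ux,
     h_plus ly uy, h_plus ly uy, - h_minus ly uy, - h_minus ly uy] ! (i - 1)"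

(* Azimuths of the four corners as seen from (ux, uy), counterclockwise from the upper right. *)

definition gamma1 :: "real \<Rightarrow> real \<Rightarrow> real \<Rightarrow> real \<Rightarrow> real" where
  "gamma1 lx ly ux uy = arctan (h_plus ly uy / h_plus lx ux)"

definition gamma2 :: "real \<Rightarrow> real \<Rightarrow> real \<Rightarrow> real \<Rightarrow> real" where
  "gamma2 lx ly ux uy = arctan (h_plus ly uy / h_minus lx ux) + pi"

definition gamma3 :: "real \<Rightarrow> real \<Rightarrow> real \<Rightarrow> real \<Rightarrow> real" where
  "gamma3 lx ly ux uy = arctan (h_minus ly uy / h_minus lx ux) + pi"

definition gamma4 :: "real \<Rightarrow> real \<Rightarrow> real \<Rightarrow> real \<Rightarrow> real" where
  "gamma4 lx ly ux uy = arctan (h_minus ly uy / h_plus lx ux) + 2 * pi"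

definition eps :: "real \<Rightarrow> real \<Rightarrow> real \<Rightarrow> real \<Rightarrow> real \<Rightarrow> nat \<Rightarrow> real \<times> real" where
  "eps lx ly ux uy \<theta> i =
    (let \<gamma>\<^sub>1 = gamma1 lx ly ux uy; \<gamma>\<^sub>2 = gamma2 lx ly ux uy;
         \<gamma>\<^sub>3 = gamma3 lx ly ux uy; \<gamma>\<^sub>4 = gamma4 lx ly ux uy
     in [(0, min \<theta> \<gamma>\<^sub>1), (\<gamma>\<^sub>4, \<theta>), (pi, min \<theta> \<gamma>\<^sub>3), (\<gamma>\<^sub>2, min \<theta> pi),
         (\<gamma>\<^sub>1, min \<theta> (pi / 2)), (pi / 2, min \<theta> \<gamma>\<^sub>2),
         (\<gamma>\<^sub>3, min \<theta> (3 * pi / 2)), (3 * pi / 2, min \<theta> \<gamma>\<^sub>4)] ! (i - 1))"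

(* For v = u the radius is 0 and every angle in [0, 2 * pi) qualifies. *)

definition is_azimuth :: "real \<times> real \<Rightarrow> real \<times> real \<Rightarrow> real \<Rightarrow> bool" where
  "is_azimuth u v \<phi> \<longleftrightarrow>
    0 \<le> \<phi> \<and> \<phi> < 2 * pi \<and> (\<exists>r\<ge>0. v - u = (r * cos \<phi>, r * sin \<phi>))"

end

theory Submission
  imports Defs
begin

text \<open>
  The four half-lines through \<open>u\<close> parallel to the axes cut the rectangle into four subrectangles with a
  corner at \<open>u\<close>. Since Lebesgue measure is invariant under rotation by a right angle, it suffices to
  treat the first quadrant. There the part of \<open>[0, a] \<times> [0, b]\<close> with azimuth at most \<open>\<phi>\<close> is the
  triangle below the line \<open>y = x tan \<phi>\<close>, of area \<open>a\<^sup>2 tan \<phi> / 2\<close>, as long as \<open>\<phi> \<le> arctan (b / a)\<close>,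
  and the whole subrectangle without a triangle of area \<open>b\<^sup>2 cot \<phi> / 2\<close> beyond that. Rotating back turns
  \<open>tan\<close> and \<open>cot\<close> into \<open>- cot\<close> and \<open>- tan\<close> in the second and the fourth quadrant, which explains
  the distribution of the eight terms over the two sums.
\<close>

section \<open>Areas of rectangles, triangles and trapezoids\<close>

lemma emeasure_lborel_Times_Icc:
  fixes a b c d :: real
  assumes "a \<le> b" "c \<le> d"
  shows "emeasure lborel ({a..b} \<times> {c..d}) = ennreal ((b - a) * (d - c))"
proof -
  have "emeasure lborel ({a..b} \<times> {c..d}) = emeasure (lborel \<Otimes>\<^sub>M lborel) ({a..b} \<times> {c..d})"
    by (simp add: lborel_prod)
  also have "\<dots> = emeasure lborel {a..b} * emeasure lborel {c..d}"
    by (intro lborel.emeasure_pair_measure_Times) auto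
  finally show ?thesis
    using assms by (simp add: ennreal_mult)
qed

text \<open>Integration over vertical slices of length \<open>x * t\<close>. The strict bound
  \<open>0 < x\<close> matches the half-open quadrant of azimuths in \<open>[0, pi / 2)\<close>,
  whose points off the origin have positive cosine.\<close>

lemma emeasure_triangle_below:
  fixes a t :: real
  assumes "0 \<le> a" "0 \<le> t"
  shows "emeasure lborel {(x, y). 0 < x \<and> x \<le> a \<and> 0 \<le> y \<and> y \<le> x * t} = ennreal (a\<^sup>2 * t / 2)"
proof -
  let ?D = "{(x, y). 0 < x \<and> x \<le> a \<and> 0 \<le> y \<and> y \<le> x * t}"
  have "{w \<in> space (borel \<Otimes>\<^sub>M borel). 0 < fst w \<and> fst w \<le> a \<and> 0 \<le> snd w \<and> snd w \<le> fst w * t}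
      \<in> sets (borel \<Otimes>\<^sub>M borel)"
    by measurable
  then have D: "?D \<in> sets (lborel \<Otimes>\<^sub>M lborel)"
    by (simp add: space_pair_measure case_prod_unfold cong: sets_pair_measure_cong)
  have "emeasure lborel ?D = emeasure (lborel \<Otimes>\<^sub>M lborel) ?D"
    by (simp add: lborel_prod)
  also have "\<dots> = (\<integral>\<^sup>+ x. emeasure lborel (Pair x -` ?D) \<partial>lborel)"
    by (rule lborel.emeasure_pair_measure_alt[OF D])
  also have "\<dots> = (\<integral>\<^sup>+ x. ennreal (x * t) * indicator {0..a} x \<partial>lborel)"
  proof (intro nn_integral_cong)
    fix x :: real
    have "Pair x -` ?D = (if 0 < x \<and> x \<le> a then {0..x * t} else {})"
      by auto
    then show "emeasure lborel (Pair x -` ?D) = ennreal (x * t) * indicator {0..a} x"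
      using assms by (auto simp: indicator_def)
  qed
  also have "\<dots> = ennreal (a\<^sup>2 * t / 2 - 0\<^sup>2 * t / 2)"
    by (rule nn_integral_FTC_Icc[where F = "\<lambda>x. x\<^sup>2 * t / 2"])
       (use assms in \<open>auto intro!: derivative_eq_intros\<close>)
  finally show ?thesis by simp
qed

text \<open>Horizontal slices are used here: each is the single interval from \<open>y / t\<close>
  to \<open>a\<close>, whereas the vertical ones change their form at \<open>x = b / t\<close>. The
  result is the rectangle minus the triangle with legs \<open>b\<close> and
  \<open>b / t\<close>.\<close>

lemma emeasure_trapezoid_below:
  fixes a b t :: real
  assumes "0 < b" "0 < t" "b \<le> a * t"
  shows "emeasure lborel {(x, y). 0 < x \<and> x \<le> a \<and> 0 \<le> y \<and> y \<le> b \<and> y \<le> x * t}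
    = ennreal (a * b - b\<^sup>2 / (2 * t))"
proof -
  let ?D = "{(x, y). 0 < x \<and> x \<le> a \<and> 0 \<le> y \<and> y \<le> b \<and> y \<le> x * t}"
  have "{w \<in> space (borel \<Otimes>\<^sub>M borel). 0 < fst w \<and> fst w \<le> a \<and> 0 \<le> snd w \<and> snd w \<le> b \<and> snd w \<le> fst w * t}
      \<in> sets (borel \<Otimes>\<^sub>M borel)"
    by measurable
  then have D: "?D \<in> sets (lborel \<Otimes>\<^sub>M lborel)"
    by (simp add: space_pair_measure case_prod_unfold cong: sets_pair_measure_cong)
  have "emeasure lborel ?D = emeasure (lborel \<Otimes>\<^sub>M lborel) ?D"
    by (simp add: lborel_prod)
  also have "\<dots> = (\<integral>\<^sup>+ y. emeasure lborel ((\<lambda>x. (x, y)) -` ?D) \<partial>lborel)"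
    by (rule lborel_pair.emeasure_pair_measure_alt2[OF D])
  also have "\<dots> = (\<integral>\<^sup>+ y. ennreal (a - y / t) * indicator {0..b} y \<partial>lborel)"
  \<comment> \<open>The height \<open>y = 0\<close> is discarded as a null set: there the bound
    \<open>0 < x\<close> makes the slice half-open instead of \<open>{y / t..a}\<close>.\<close>
  proof (rule nn_integral_cong_AE, rule AE_mp[OF AE_lborel_singleton[of 0]], rule AE_I2, rule impI)
    fix y :: real
    assume "y \<noteq> 0"
    have "0 < x" if "y / t \<le> x" "0 \<le> y" for x
      using that \<open>y \<noteq> 0\<close> assms by (smt (verit) divide_pos_pos)
    moreover have "y \<le> x * t \<longleftrightarrow> y / t \<le> x" for x
      using assms by (simp add: pos_divide_le_eq)
    ultimately have "(\<lambda>x. (x, y)) -` ?D = (if 0 \<le> y \<and> y \<le> b then {y / t..a} else {})"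
      by auto
    moreover have "y / t \<le> a" if "y \<le> b"
      using that assms by (simp add: field_simps)
    ultimately show "emeasure lborel ((\<lambda>x. (x, y)) -` ?D) = ennreal (a - y / t) * indicator {0..b} y"
      using \<open>y \<noteq> 0\<close> by (auto simp: indicator_def)
  qed
  also have "\<dots> = ennreal ((a * b - b\<^sup>2 / (2 * t)) - (a * 0 - 0\<^sup>2 / (2 * t)))"
  proof (rule nn_integral_FTC_Icc[where F = "\<lambda>y. a * y - y\<^sup>2 / (2 * t)"])
    show "0 \<le> a - y / t" if "y \<in> {0..b}" for y
      using that assms by (simp add: field_simps)
    show "((\<lambda>y. a * y - y\<^sup>2 / (2 * t)) has_real_derivative a - y / t) (at y)" for y
      using assms by (auto intro!: derivative_eq_intros simp: field_simps)
  qed (use assms in auto)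
  finally show ?thesis by simp
qed

section \<open>Measure-preserving maps and uniform measures\<close>

text \<open>The map is the clockwise rotation by a right angle. It pulls boxes back to boxes with
  the two side lengths swapped, and the values on boxes determine Lebesgue measure.\<close>

lemma distr_lborel_rotate:
  "distr lborel lborel (\<lambda>w :: real \<times> real. (snd w, - fst w)) = lborel"
proof -
  have "lborel = distr lborel borel (\<lambda>w :: real \<times> real. (snd w, - fst w))"
  proof (rule lborel_eqI)
    fix l u :: "real \<times> real"
    assume le: "\<And>b. b \<in> Basis \<Longrightarrow> l \<bullet> b \<le> u \<bullet> b"
    obtain l1 l2 u1 u2 where lu: "l = (l1, l2)" "u = (u1, u2)"
      by fastforce
    have le': "l1 \<le> u1" "l2 \<le> u2"
      using le[of "(1, 0)"] le[of "(0, 1)"] by (auto simp: lu Basis_prod_def)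
    have "(\<lambda>w :: real \<times> real. (snd w, - fst w)) -` box l u = box (- u2, l1) (- l2, u1)"
      by (auto simp: lu box_def Basis_prod_def)
    then show "emeasure (distr lborel borel (\<lambda>w. (snd w, - fst w))) (box l u) =
        ennreal (prod ((\<bullet>) (u - l)) Basis)"
      using le' by (subst emeasure_distr)
        (auto simp: lu emeasure_lborel_box_eq Basis_prod_def prod.union_disjoint mult.commute
          intro!: borel_measurable_continuous_onI continuous_on_Pair continuous_on_snd continuous_on_minus
            continuous_on_fst continuous_on_id)
  qed simp
  then show ?thesis
    by (simp cong: distr_cong)
qed

text \<open>A measure-preserving map gives \<open>A\<close> and its preimage the same mass, so
  normalization survives the push-forward. This serves both the rotation and the
  translation.\<close>

lemma distr_uniform_measure_vimage:
  assumes [measurable]: "g \<in> measurable N N" and "distr N N g = N" and [measurable]: "A \<in> sets N"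
    and "B = g -` A \<inter> space N"
  shows "distr (uniform_measure N B) N g = uniform_measure N A"
proof (rule measure_eqI)
  fix C assume "C \<in> sets (distr (uniform_measure N B) N g)"
  then have C [measurable]: "C \<in> sets N" by simp
  have eq: "emeasure N (g -` S \<inter> space N) = emeasure N S" if "S \<in> sets N" for S
    using emeasure_distr[OF assms(1) that] assms(2) by simp
  have [measurable]: "B \<in> sets N"
    unfolding assms(4) by measurable
  have "B \<inter> (g -` C \<inter> space N) = g -` (A \<inter> C) \<inter> space N"
    using assms(4) by auto
  then have "emeasure N (B \<inter> (g -` C \<inter> space N)) = emeasure N (A \<inter> C)"
    by (simp add: eq del: vimage_Int)
  moreover have "emeasure N B = emeasure N A"
    by (simp add: assms(4) eq)
  ultimately show "emeasure (distr (uniform_measure N B) N g) C = emeasure (uniform_measure N A) C"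
    by (simp add: emeasure_distr)
qed simp

section \<open>The sector of azimuths in the first quadrant\<close>

text \<open>The range of \<open>x\<close> covers \<open>\<Theta> - k \<pi> / 2\<close> for \<open>k = 0, 1, 2, 3\<close> at once.\<close>

lemma in_first_quadrant_iff:
  assumes "- (3 * pi / 2) \<le> x" "x < 2 * pi"
  shows "0 < cos x \<and> 0 \<le> sin x \<longleftrightarrow> 0 \<le> x \<and> x < pi / 2"
proof
  assume pos: "0 < cos x \<and> 0 \<le> sin x"
  \<comment> \<open>The complement of the quadrant splits into four ranges. A shift by
    \<open>pi\<close> reverses the signs of \<open>cos\<close> and \<open>sin\<close> and moves each
    range to where the relevant function is known to be nonnegative or positive.\<close>
  have "\<not> x \<le> - pi"
    using cos_ge_zero[of "x + pi"] pos assms by auto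
  moreover have "\<not> (- pi < x \<and> x < 0)"
    using sin_gt_zero[of "x + pi"] pos by auto
  moreover have "\<not> (pi / 2 \<le> x \<and> x \<le> 3 * pi / 2)"
    using cos_ge_zero[of "x - pi"] pos by auto
  moreover have "\<not> 3 * pi / 2 < x"
    using sin_gt_zero[of "x - pi"] pos assms by auto
  ultimately show "0 \<le> x \<and> x < pi / 2"
    by linarith
next
  assume "0 \<le> x \<and> x < pi / 2"
  then show "0 < cos x \<and> 0 \<le> sin x"
    using cos_gt_zero_pi[of x] sin_ge_zero[of x] pi_gt_zero by auto
qed

lemma cot_pi_half: "cot (pi / 2 :: real) = 0"
  by (simp add: cot_def)

text \<open>The ray at azimuth \<open>\<phi>\<close> leaves the rectangle through the right side up
  to \<open>\<gamma>\<close> and through the top side afterwards. The guard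
  \<open>\<phi> < pi / 2\<close> is there because \<open>tan\<close> no longer describes the slope
  of a bounding ray from \<open>pi / 2\<close> on; in HOL, \<open>tan (pi / 2)\<close> is 0. The
  minima and the zero branch of \<open>increment\<close> let one formula cover all real
  \<open>\<phi>\<close>.\<close>

lemma measure_rectangle_sector:
  fixes a b \<phi> :: real
  assumes "0 < a" "0 < b"
  defines "\<gamma> \<equiv> arctan (b / a)"
  shows "measure lborel {(x, y). 0 < x \<and> x \<le> a \<and> 0 \<le> y \<and> y \<le> b \<and> 0 \<le> \<phi> \<and> (\<phi> < pi / 2 \<longrightarrow> y \<le> x * tan \<phi>)}
    = (a\<^sup>2 * increment tan 0 (min \<phi> \<gamma>) - b\<^sup>2 * increment cot \<gamma> (min \<phi> (pi / 2))) / 2"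
    (is "measure lborel ?D = _")
proof -
  have tan_\<gamma>: "tan \<gamma> = b / a" and \<gamma>: "0 < \<gamma>" "\<gamma> < pi / 2"
    using assms arctan_ubound[of "b / a"] by (auto simp: tan_arctan)
  have cot_\<gamma>: "cot \<gamma> = a / b"
    using tan_\<gamma> by (simp add: cot_altdef)
  consider "\<phi> < 0" | "0 \<le> \<phi>" "\<phi> \<le> \<gamma>" | "\<gamma> < \<phi>" "\<phi> < pi / 2" | "pi / 2 \<le> \<phi>"
    by linarith
  then show ?thesis
  proof cases
    case 1
    then have "?D = {}" by auto
    then show ?thesis
      using 1 \<gamma> unfolding increment_def by simp
  next
    case 2
    have t: "0 \<le> tan \<phi>" "tan \<phi> \<le> b / a"
      using 2 \<gamma> tan_mono_le[of 0 \<phi>] tan_mono_le[of \<phi> \<gamma>] tan_\<gamma> by auto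
    have "x * tan \<phi> \<le> b" if "0 < x" "x \<le> a" for x
      using mult_mono[of x a "tan \<phi>" "b / a"] that t assms by auto
    then have "?D = {(x, y). 0 < x \<and> x \<le> a \<and> 0 \<le> y \<and> y \<le> x * tan \<phi>}"
      using 2 \<gamma> by fastforce
    then have "measure lborel ?D = a\<^sup>2 * tan \<phi> / 2"
      using emeasure_triangle_below[of a "tan \<phi>"] t assms by (simp add: Sigma_Algebra.measure_def)
    then show ?thesis
      using 2 \<gamma> by (auto simp: increment_def)
  next
    case 3
    have t: "b / a < tan \<phi>"
      using 3 \<gamma> tan_monotone[of \<gamma> \<phi>] tan_\<gamma> by auto
    then have tpos: "0 < tan \<phi>" "b \<le> a * tan \<phi>"
      using assms by (auto simp: field_simps intro: less_trans[of 0 "b / a"])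
    have "?D = {(x, y). 0 < x \<and> x \<le> a \<and> 0 \<le> y \<and> y \<le> b \<and> y \<le> x * tan \<phi>}"
      using 3 \<gamma> by auto
    \<comment> \<open>Since \<open>ennreal\<close> truncates negative reals to 0, the area can be
      read back as a real only once it is known to be nonnegative.\<close>
    moreover have "0 \<le> a * b - b\<^sup>2 / (2 * tan \<phi>)"
    proof -
      have "b * b \<le> b * (a * tan \<phi>)" "0 \<le> b * (a * tan \<phi>)"
        using tpos assms by (auto intro!: mult_left_mono)
      then have "b * b \<le> 2 * (b * (a * tan \<phi>))"
        by linarith
      then show ?thesis
        using tpos by (simp add: field_simps power2_eq_square)
    qed
    ultimately have "measure lborel ?D = a * b - b\<^sup>2 / (2 * tan \<phi>)"
      using emeasure_trapezoid_below[of b "tan \<phi>" a] tpos assms by (simp add: Sigma_Algebra.measure_def)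
    \<comment> \<open>Both \<open>a\<^sup>2 * tan \<gamma>\<close> and
      \<open>b\<^sup>2 * cot \<gamma>\<close> equal \<open>a * b\<close>; their halves add up to the
      full area, from which the \<open>cot \<phi>\<close> term is subtracted.\<close>
    also have "a * b - b\<^sup>2 / (2 * tan \<phi>) =
        (a\<^sup>2 * increment tan 0 (min \<phi> \<gamma>) - b\<^sup>2 * increment cot \<gamma> (min \<phi> (pi / 2))) / 2"
      using 3 \<gamma> assms(1,2) tpos
      by (simp add: increment_def tan_\<gamma> cot_\<gamma> cot_altdef[of \<phi>] field_simps power2_eq_square)
    finally show ?thesis .
  next
    case 4
    have "0 \<le> \<phi>"
      using 4 pi_half_ge_zero by linarith
    then have "?D = {0<..a} \<times> {0..b}"
      using 4 by auto
    then have "emeasure lborel ?D = emeasure (lborel \<Otimes>\<^sub>M lborel) ({0<..a} \<times> {0..b})"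
      by (simp add: lborel_prod)
    also have "\<dots> = emeasure lborel {0<..a} * emeasure lborel {0..b}"
      by (intro lborel.emeasure_pair_measure_Times) auto
    also have "\<dots> = ennreal (a * b)"
      using assms by (simp add: ennreal_mult)
    finally have "measure lborel ?D = a * b"
      using assms by (simp add: Sigma_Algebra.measure_def)
    moreover have "min \<phi> (pi / 2) = pi / 2"
      using 4 by simp
    moreover from this have "a * b = (a\<^sup>2 * increment tan 0 (min \<phi> \<gamma>) - b\<^sup>2 * increment cot \<gamma> (min \<phi> (pi / 2))) / 2"
      using 4 \<gamma> assms(1,2) cot_pi_half
      by (simp add: increment_def tan_\<gamma> cot_\<gamma> field_simps power2_eq_square)
    ultimately show ?thesis by simp
  qed
qed

text \<open>Almost surely the event says that \<open>W\<close> lies in the planar sector measured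
  above, so its probability is a quotient of areas. General bounds \<open>p\<close>,
  \<open>q\<close> and the wide range of \<open>\<Phi>\<close> make this applicable to each rotated
  copy of the rectangle.\<close>

lemma (in prob_space) prob_first_quadrant_sector:
  fixes W :: "'a \<Rightarrow> real \<times> real" and \<Phi> :: "'a \<Rightarrow> real" and a b p q \<phi> :: real
  assumes [measurable]: "W \<in> measurable M lborel" "\<Phi> \<in> borel_measurable M"
    and unif: "distr M lborel W = uniform_measure lborel ({p..a} \<times> {q..b})"
    and bnds: "p < 0" "0 < a" "q < 0" "0 < b"
    and polar: "\<And>\<omega>. \<omega> \<in> space M \<Longrightarrow> \<exists>r\<ge>0. W \<omega> = (r * cos (\<Phi> \<omega>), r * sin (\<Phi> \<omega>))"
    and range: "\<And>\<omega>. \<omega> \<in> space M \<Longrightarrow> - (3 * pi / 2) \<le> \<Phi> \<omega> \<and> \<Phi> \<omega> < 2 * pi"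
  defines "\<gamma> \<equiv> arctan (b / a)"
  shows "prob {\<omega> \<in> space M. 0 \<le> \<Phi> \<omega> \<and> \<Phi> \<omega> < pi / 2 \<and> \<Phi> \<omega> \<le> \<phi>} =
    (a\<^sup>2 * increment tan 0 (min \<phi> \<gamma>) - b\<^sup>2 * increment cot \<gamma> (min \<phi> (pi / 2)))
      / (2 * ((a - p) * (b - q)))"
proof -
  let ?R = "{p..a} \<times> {q..b}"
  let ?D = "{(x, y). 0 < x \<and> x \<le> a \<and> 0 \<le> y \<and> y \<le> b \<and> 0 \<le> \<phi> \<and> (\<phi> < pi / 2 \<longrightarrow> y \<le> x * tan \<phi>)}"
  have R: "emeasure lborel ?R = ennreal ((a - p) * (b - q))"
    using bnds by (intro emeasure_lborel_Times_Icc) auto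
  then have mR: "measure lborel ?R = (a - p) * (b - q)"
    using bnds by (simp add: Sigma_Algebra.measure_def)
  have Rs: "?R \<in> sets lborel"
    by (simp add: borel_closed closed_Times)
  have "{w \<in> space (borel \<Otimes>\<^sub>M borel). 0 < fst w \<and> fst w \<le> a \<and> 0 \<le> snd w \<and> snd w \<le> b \<and>
      0 \<le> \<phi> \<and> (\<phi> < pi / 2 \<longrightarrow> snd w \<le> fst w * tan \<phi>)} \<in> sets (borel \<Otimes>\<^sub>M borel)"
    by measurable
  then have D [measurable]: "?D \<in> sets lborel"
    unfolding sets_lborel borel_prod[symmetric] by (simp add: space_pair_measure case_prod_unfold)
  \<comment> \<open>The origin has to be excluded because there the polar form holds with radius 0
    for any angle, so \<open>\<Phi>\<close> carries no information.\<close>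
  have "AE w in uniform_measure lborel ?R. w \<in> ?R \<and> w \<noteq> 0"
    using AE_lborel_singleton[of "0 :: real \<times> real"] by (intro AE_uniform_measureI[OF Rs]) auto
  then have AE_W: "AE \<omega> in M. W \<omega> \<in> ?R \<and> W \<omega> \<noteq> 0"
    unfolding unif[symmetric] by (rule AE_distrD[OF \<open>W \<in> measurable M lborel\<close>])
  have key: "(0 \<le> \<Phi> \<omega> \<and> \<Phi> \<omega> < pi / 2 \<and> \<Phi> \<omega> \<le> \<phi>) \<longleftrightarrow> W \<omega> \<in> ?D"
    if \<omega>: "\<omega> \<in> space M" and W: "W \<omega> \<in> ?R" "W \<omega> \<noteq> 0" for \<omega>
  proof -
    obtain r where r: "0 \<le> r" "W \<omega> = (r * cos (\<Phi> \<omega>), r * sin (\<Phi> \<omega>))"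
      using polar \<omega> by blast
    with W have "0 < r"
      by (cases "r = 0") (auto simp: zero_prod_def)
    have quad: "0 < cos (\<Phi> \<omega>) \<and> 0 \<le> sin (\<Phi> \<omega>) \<longleftrightarrow> 0 \<le> \<Phi> \<omega> \<and> \<Phi> \<omega> < pi / 2"
      using in_first_quadrant_iff range \<omega> by blast
    \<comment> \<open>Division by the positive cosine turns the linear inequality into a comparison
      of tangents, and \<open>tan\<close> is strictly increasing on the quadrant. For
      \<open>\<phi>\<close> at least \<open>pi / 2\<close> both sides are true.\<close>
    have angle: "\<Phi> \<omega> \<le> \<phi> \<longleftrightarrow> 0 \<le> \<phi> \<and> (\<phi> < pi / 2 \<longrightarrow> sin (\<Phi> \<omega>) \<le> cos (\<Phi> \<omega>) * tan \<phi>)"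
      if "0 \<le> \<Phi> \<omega>" "\<Phi> \<omega> < pi / 2"
    proof -
      have "0 < cos (\<Phi> \<omega>)"
        using quad that by auto
      then have "sin (\<Phi> \<omega>) \<le> cos (\<Phi> \<omega>) * tan \<phi> \<longleftrightarrow> tan (\<Phi> \<omega>) \<le> tan \<phi>"
        by (simp add: fun_cong[OF tan_def, of "\<Phi> \<omega>"] pos_divide_le_eq mult.commute)
      moreover have "tan (\<Phi> \<omega>) \<le> tan \<phi> \<longleftrightarrow> \<Phi> \<omega> \<le> \<phi>" if "0 \<le> \<phi>" "\<phi> < pi / 2"
        using that \<open>0 \<le> \<Phi> \<omega>\<close> \<open>\<Phi> \<omega> < pi / 2\<close> by (intro tan_mono_le_eq) auto
      ultimately show ?thesis
        using that by (cases "\<phi> < pi / 2") auto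
    qed
    show ?thesis
      using W(1) \<open>0 < r\<close> quad angle bnds
      by (auto simp: r(2) zero_less_mult_iff zero_le_mult_iff mult.assoc)
  qed
  from AE_W AE_space have "AE \<omega> in M. (0 \<le> \<Phi> \<omega> \<and> \<Phi> \<omega> < pi / 2 \<and> \<Phi> \<omega> \<le> \<phi>) \<longleftrightarrow> W \<omega> \<in> ?D"
  proof eventually_elim
    case (elim \<omega>)
    then show ?case by (intro key) auto
  qed
  moreover have "W -` ?D \<inter> space M \<in> events"
    using measurable_sets[OF assms(1) D] .
  ultimately have "prob {\<omega> \<in> space M. 0 \<le> \<Phi> \<omega> \<and> \<Phi> \<omega> < pi / 2 \<and> \<Phi> \<omega> \<le> \<phi>} = prob (W -` ?D \<inter> space M)"
    by (intro finite_measure_eq_AE) (auto elim!: AE_mp intro!: AE_I2)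
  also have "\<dots> = measure (uniform_measure lborel ?R) ?D"
    unfolding unif[symmetric] by (rule measure_distr[OF assms(1) D, symmetric])
  also have "\<dots> = measure lborel ?D / measure lborel ?R"
  proof -
    have "?R \<inter> ?D = ?D" using bnds by auto
    moreover have "0 < (a - p) * (b - q)"
      using bnds by (intro mult_pos_pos) auto
    then have "emeasure lborel ?R \<noteq> 0" "emeasure lborel ?R \<noteq> \<infinity>"
      unfolding R by (auto simp: ennreal_eq_0_iff simp del: zero_less_mult_iff)
    ultimately show ?thesis
      using measure_uniform_measure[of lborel ?R ?D] D by simp
  qed
  finally show ?thesis
    unfolding measure_rectangle_sector[OF bnds(2,4)] mR \<gamma>_def by simp
qed

section \<open>Rotated and translated uniform random points\<close>

text \<open>The conclusions have the form of the hypotheses, so that the rotation can be iterated to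
  reach all four quadrants.\<close>

lemma distr_uniform_rotate:
  fixes W :: "'a \<Rightarrow> real \<times> real" and p q a b :: real
  assumes [measurable]: "W \<in> measurable M lborel"
    and unif: "distr M lborel W = uniform_measure lborel ({p..a} \<times> {q..b})"
  shows "distr M lborel (\<lambda>\<omega>. (snd (W \<omega>), - fst (W \<omega>))) = uniform_measure lborel ({q..b} \<times> {- a..- p})"
    and "(\<lambda>\<omega>. (snd (W \<omega>), - fst (W \<omega>))) \<in> measurable M lborel"
proof -
  let ?g = "\<lambda>w :: real \<times> real. (snd w, - fst w)"
  have g [measurable]: "?g \<in> measurable lborel lborel"
    by (auto intro!: borel_measurable_continuous_onI continuous_on_Pair continuous_on_snd
        continuous_on_minus continuous_on_fst continuous_on_id)
  have "distr M lborel (\<lambda>\<omega>. ?g (W \<omega>)) = distr (distr M lborel W) lborel ?g"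
    by (simp add: distr_distr[OF g assms(1)] comp_def)
  also have "\<dots> = uniform_measure lborel ({q..b} \<times> {- a..- p})"
    unfolding unif
    by (rule distr_uniform_measure_vimage[OF g distr_lborel_rotate])
      (auto simp: borel_closed closed_Times)
  finally show "distr M lborel (\<lambda>\<omega>. ?g (W \<omega>)) = uniform_measure lborel ({q..b} \<times> {- a..- p})" .
  show "(\<lambda>\<omega>. ?g (W \<omega>)) \<in> measurable M lborel"
    by measurable
qed

lemma distr_uniform_shift:
  fixes W :: "'a \<Rightarrow> real \<times> real" and p q a b :: real
  assumes [measurable]: "W \<in> measurable M lborel"
    and unif: "distr M lborel W = uniform_measure lborel ({p..a} \<times> {q..b})"
  shows "distr M lborel (\<lambda>\<omega>. W \<omega> - u) =
      uniform_measure lborel ({p - fst u..a - fst u} \<times> {q - snd u..b - snd u})"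
    and "(\<lambda>\<omega>. W \<omega> - u) \<in> measurable M lborel"
proof -
  let ?g = "\<lambda>w :: real \<times> real. w - u"
  have g [measurable]: "?g \<in> measurable lborel lborel"
    by simp
  have dg: "distr lborel lborel ?g = lborel"
    using lborel_distr_plus[of "- u"] by (simp cong: distr_cong)
  have "distr M lborel (\<lambda>\<omega>. ?g (W \<omega>)) = distr (distr M lborel W) lborel ?g"
    by (simp add: distr_distr[OF g assms(1)] comp_def)
  also have "\<dots> = uniform_measure lborel ({p - fst u..a - fst u} \<times> {q - snd u..b - snd u})"
    unfolding unif
    by (rule distr_uniform_measure_vimage[OF g dg])
      (cases u; auto simp: borel_closed closed_Times)+
  finally show "distr M lborel (\<lambda>\<omega>. ?g (W \<omega>)) =
      uniform_measure lborel ({p - fst u..a - fst u} \<times> {q - snd u..b - snd u})" .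
  show "(\<lambda>\<omega>. ?g (W \<omega>)) \<in> measurable M lborel"
    by measurable
qed

section \<open>Increments of \<open>tan\<close> and \<open>cot\<close> under shifts by multiples of
  \<open>pi / 2\<close>\<close>

text \<open>Carries increments computed in a rotated frame back to the original azimuths:
  subtracting \<open>c\<close> from both bounds preserves their order.\<close>

lemma increment_cong_shift:
  assumes "\<And>x. f (x - c) = g x"
  shows "increment f (a - c) (b - c) = increment g a b"
  using assms by (simp add: increment_def)

lemma increment_uminus: "increment (\<lambda>x. - f x) a b = - increment f a b"
  by (simp add: increment_def)

text \<open>True at the poles as well: both sides reduce to the same quotient, and division by zero
  gives 0. The other shift identities need no side condition for the same reason.\<close>

lemma tan_minus_pi_half: "tan (x - pi / 2) = - cot x"
  by (simp add: tan_def cot_def sin_diff cos_diff)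

lemma cot_minus_pi_half: "cot (x - pi / 2) = - tan x"
  by (simp add: tan_def cot_def sin_diff cos_diff)

lemma tan_minus_pi: "tan (x - pi) = tan x"
  by (simp add: tan_def)

lemma cot_minus_pi: "cot (x - pi) = cot x"
  by (simp add: cot_def)

lemma tan_minus_3pi_half: "tan (x - 3 * pi / 2) = - cot x"
  using tan_minus_pi_half[of "x - pi"] by (simp add: cot_minus_pi)

lemma cot_minus_3pi_half: "cot (x - 3 * pi / 2) = - tan x"
  using cot_minus_pi_half[of "x - pi"] by (simp add: tan_minus_pi)

lemma sum_1_4: "(\<Sum>i = 1..4. f i) = f 1 + f 2 + f 3 + f (4 :: nat)" for f :: "nat \<Rightarrow> real"
  by (simp add: eval_nat_numeral)

lemma sum_5_8: "(\<Sum>i = 5..8. f i) = f 5 + f 6 + f 7 + f (8 :: nat)" for f :: "nat \<Rightarrow> real"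
  by (simp add: eval_nat_numeral)

section \<open>The distribution function assembled from the four quadrants\<close>

theorem corollary4:
  fixes M :: "'a measure" and V :: "'a \<Rightarrow> real \<times> real" and \<Theta> :: "'a \<Rightarrow> real"
    and lx ly ux uy \<theta> :: real
  assumes "prob_space M"
    and "lx > 0" and "ly > 0"
    and "\<bar>ux\<bar> < lx / 2" and "\<bar>uy\<bar> < ly / 2"
    and "distributed M lborel V
           (\<lambda>v. indicator (rectangle lx ly) v / measure lborel (rectangle lx ly))"
    and "\<Theta> \<in> borel_measurable M"
    and "\<forall>\<omega>\<in>space M. is_azimuth (ux, uy) (V \<omega>) (\<Theta> \<omega>)"
    and "0 \<le> \<theta>" and "\<theta> \<le> 2 * pi"
  shows "cdf (distr M borel \<Theta>) \<theta> =
    1 / (2 * lx * ly) *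
      ((\<Sum>i = 1..4. (h lx ly ux uy i)\<^sup>2 *
          increment tan (fst (eps lx ly ux uy \<theta> i)) (snd (eps lx ly ux uy \<theta> i))) -
       (\<Sum>i = 5..8. (h lx ly ux uy i)\<^sup>2 *
          increment cot (fst (eps lx ly ux uy \<theta> i)) (snd (eps lx ly ux uy \<theta> i))))"
proof -
  interpret prob_space M by fact
  define a p b q where "a = h_plus lx ux" and "p = h_minus lx ux"
    and "b = h_plus ly uy" and "q = h_minus ly uy"
  note apbq = this
  have pos: "0 < a" "p < 0" "0 < b" "q < 0" and size: "a - p = lx" "b - q = ly"
    using assms(4,5) by (auto simp: apbq h_plus_def h_minus_def)
  have \<Theta> [measurable]: "\<Theta> \<in> borel_measurable M" by fact
  have V: "V \<in> measurable M lborel"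
    using assms(6) by (rule distributed_measurable)

  have R: "emeasure lborel (rectangle lx ly) = ennreal (lx * ly)"
    using emeasure_lborel_Times_Icc[of "- lx / 2" "lx / 2" "- ly / 2" "ly / 2"] assms(2,3)
    by (simp add: rectangle_def)
  then have mR: "measure lborel (rectangle lx ly) = lx * ly"
    using assms(2,3) by (simp add: Sigma_Algebra.measure_def)
  have "distr M lborel V = density lborel (\<lambda>v. ennreal (indicator (rectangle lx ly) v / measure lborel (rectangle lx ly)))"
    using assms(6) by (simp add: distributed_distr_eq_density)
  also have "\<dots> = uniform_measure lborel (rectangle lx ly)"
    unfolding uniform_measure_def R mR using assms(2,3)
    by (intro arg_cong[of _ _ "density lborel"] ext)
      (auto simp: indicator_def ennreal_1[symmetric] divide_ennreal simp del: ennreal_1)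
  finally have unif: "distr M lborel V = uniform_measure lborel ({- lx / 2..lx / 2} \<times> {- ly / 2..ly / 2})"
    by (simp add: rectangle_def)

  \<comment> \<open>\<open>W0\<close> moves the reference point to the origin, and each further
    rotation lowers the azimuth by \<open>pi / 2\<close>. Thus the quadrants two, three and four
    become the first quadrant for \<open>W1\<close>, \<open>W2\<close> and
    \<open>W3\<close>.\<close>
  define W0 where "W0 = (\<lambda>\<omega>. V \<omega> - (ux, uy))"
  define W1 where "W1 = (\<lambda>\<omega>. (snd (W0 \<omega>), - fst (W0 \<omega>)))"
  define W2 where "W2 = (\<lambda>\<omega>. (snd (W1 \<omega>), - fst (W1 \<omega>)))"
  define W3 where "W3 = (\<lambda>\<omega>. (snd (W2 \<omega>), - fst (W2 \<omega>)))"
  have W0: "distr M lborel W0 = uniform_measure lborel ({p..a} \<times> {q..b})" "W0 \<in> measurable M lborel"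
    using distr_uniform_shift[OF V unif, of "(ux, uy)"]
    by (auto simp: W0_def apbq h_plus_def h_minus_def)
  have W1: "distr M lborel W1 = uniform_measure lborel ({q..b} \<times> {- a..- p})" "W1 \<in> measurable M lborel"
    using distr_uniform_rotate[OF W0(2,1)] by (auto simp: W1_def)
  have W2: "distr M lborel W2 = uniform_measure lborel ({- a..- p} \<times> {- b..- q})" "W2 \<in> measurable M lborel"
    using distr_uniform_rotate[OF W1(2,1)] by (auto simp: W2_def)
  have W3: "distr M lborel W3 = uniform_measure lborel ({- b..- q} \<times> {p..a})" "W3 \<in> measurable M lborel"
    using distr_uniform_rotate[OF W2(2,1)] by (auto simp: W3_def)

  have range: "0 \<le> \<Theta> \<omega>" "\<Theta> \<omega> < 2 * pi"
    and polar: "\<exists>r\<ge>0. W0 \<omega> = (r * cos (\<Theta> \<omega>), r * sin (\<Theta> \<omega>))" if "\<omega> \<in> space M" for \<omega>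
    using assms(8) that by (auto simp: is_azimuth_def W0_def)
  have polar1: "\<exists>r\<ge>0. W1 \<omega> = (r * cos (\<Theta> \<omega> - pi / 2), r * sin (\<Theta> \<omega> - pi / 2))" if "\<omega> \<in> space M" for \<omega>
    using polar[OF that] by (auto simp: W1_def cos_diff sin_diff)
  have polar2: "\<exists>r\<ge>0. W2 \<omega> = (r * cos (\<Theta> \<omega> - pi), r * sin (\<Theta> \<omega> - pi))" if "\<omega> \<in> space M" for \<omega>
    using polar[OF that] by (auto simp: W1_def W2_def)
  have polar3: "\<exists>r\<ge>0. W3 \<omega> = (r * cos (\<Theta> \<omega> - 3 * pi / 2), r * sin (\<Theta> \<omega> - 3 * pi / 2))" if "\<omega> \<in> space M" for \<omega>
  proof -
    have "cos (x - 3 * pi / 2) = - sin x" "sin (x - 3 * pi / 2) = cos x" for x :: real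
    proof -
      have "x - 3 * pi / 2 = x - pi / 2 - pi"
        by simp
      then show "cos (x - 3 * pi / 2) = - sin x" "sin (x - 3 * pi / 2) = cos x"
        by (simp_all only: cos_minus_pi sin_minus_pi) (simp_all add: cos_diff sin_diff)
    qed
    then show ?thesis
      using polar[OF that] by (auto simp: W1_def W2_def W3_def)
  qed

  \<comment> \<open>For \<open>c\<close> equal to 0, \<open>pi / 2\<close>, \<open>pi\<close> and
    \<open>3 * pi / 2\<close> the half-open ranges of length \<open>pi / 2\<close> from
    \<open>c\<close> partition \<open>[0, 2 * pi)\<close>. Subtracting \<open>c\<close> everywhere
    gives the event of the quadrant lemma for the angle \<open>\<Theta> \<omega> - c\<close> and the
    bound \<open>\<theta> - c\<close>.\<close>
  let ?E = "\<lambda>c. {\<omega> \<in> space M. 0 \<le> \<Theta> \<omega> - c \<and> \<Theta> \<omega> - c < pi / 2 \<and> \<Theta> \<omega> - c \<le> \<theta> - c}"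
  have E: "?E c \<in> events" for c
    by measurable
  have "cdf (distr M borel \<Theta>) \<theta> = prob (\<Theta> -` {..\<theta>} \<inter> space M)"
    by (simp add: cdf_def measure_distr)
  also have "\<Theta> -` {..\<theta>} \<inter> space M = ?E 0 \<union> ?E (pi / 2) \<union> ?E pi \<union> ?E (3 * pi / 2)"
    using range by fastforce
  also have "prob \<dots> = prob (?E 0) + prob (?E (pi / 2)) + prob (?E pi) + prob (?E (3 * pi / 2))"
    by (subst finite_measure_Union[OF _ E] | blast intro: E sets.Un | force)+
  finally have cdf: "cdf (distr M borel \<Theta>) \<theta> =
    prob (?E 0) + prob (?E (pi / 2)) + prob (?E pi) + prob (?E (3 * pi / 2))" .

  let ?\<gamma>1 = "gamma1 lx ly ux uy" and ?\<gamma>2 = "gamma2 lx ly ux uy"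
    and ?\<gamma>3 = "gamma3 lx ly ux uy" and ?\<gamma>4 = "gamma4 lx ly ux uy"
  have g1: "arctan (b / a) = ?\<gamma>1"
    by (simp add: gamma1_def apbq)
  \<comment> \<open>A right-angle rotation swaps the legs at the corner, and for positive
    \<open>x\<close> the values \<open>arctan x\<close> and \<open>arctan (1 / x)\<close> sum to
    \<open>pi / 2\<close>. The half turn in \<open>g3\<close> only changes both signs;
    \<open>g4\<close> again needs the reciprocal.\<close>
  have g2: "arctan (- p / b) = ?\<gamma>2 - pi / 2"
    using arctan_inverse[of "b / - p"] pos
    by (simp add: gamma2_def apbq[symmetric] arctan_minus divide_pos_neg)
  have g3: "arctan (- q / - p) = ?\<gamma>3 - pi"
    by (simp add: gamma3_def apbq)
  have g4: "arctan (a / - q) = ?\<gamma>4 - 3 * pi / 2"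
    using arctan_inverse[of "- q / a"] pos
    by (simp add: gamma4_def apbq[symmetric] arctan_minus divide_neg_pos)
  \<comment> \<open>The four quadrants supply, in order, the summands 1 and 5, 6 and 4, 3 and 7, 8
    and 2 of the claim.\<close>
  have P0: "prob (?E 0) = (a\<^sup>2 * increment tan 0 (min \<theta> ?\<gamma>1) - b\<^sup>2 * increment cot ?\<gamma>1 (min \<theta> (pi / 2)))
      / (2 * (lx * ly))"
    using prob_first_quadrant_sector[OF W0(2) \<Theta> W0(1), of \<theta>] pos polar range size
    by (force simp: g1)
  have P1: "prob (?E (pi / 2)) =
      (- b\<^sup>2 * increment cot (pi / 2) (min \<theta> ?\<gamma>2) + p\<^sup>2 * increment tan ?\<gamma>2 (min \<theta> pi)) / (2 * (lx * ly))"
  proof -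
    have "increment tan 0 (min (\<theta> - pi / 2) (?\<gamma>2 - pi / 2)) = - increment cot (pi / 2) (min \<theta> ?\<gamma>2)"
      using increment_cong_shift[of tan "pi / 2" "\<lambda>x. - cot x" "pi / 2" "min \<theta> ?\<gamma>2", OF tan_minus_pi_half]
      by (simp add: increment_uminus min_diff_distrib_left)
    moreover have "increment cot (?\<gamma>2 - pi / 2) (min (\<theta> - pi / 2) (pi / 2)) = - increment tan ?\<gamma>2 (min \<theta> pi)"
      using increment_cong_shift[of cot "pi / 2" "\<lambda>x. - tan x" ?\<gamma>2 "min \<theta> pi", OF cot_minus_pi_half]
      by (simp add: increment_uminus min_diff_distrib_left)
    moreover have "prob (?E (pi / 2)) = (b\<^sup>2 * increment tan 0 (min (\<theta> - pi / 2) (arctan (- p / b)))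
        - (- p)\<^sup>2 * increment cot (arctan (- p / b)) (min (\<theta> - pi / 2) (pi / 2)))
          / (2 * ((b - q) * (- p - - a)))"
    proof (rule prob_first_quadrant_sector[OF W1(2) _ W1(1) _ _ _ _ polar1])
      show "- (3 * pi / 2) \<le> \<Theta> \<omega> - pi / 2 \<and> \<Theta> \<omega> - pi / 2 < 2 * pi" if "\<omega> \<in> space M" for \<omega>
        using range[OF that] pi_gt_zero by linarith
    qed (use pos in auto)
    ultimately show ?thesis
      using size by (simp only: g2) (simp add: mult.commute)
  qed
  have P2: "prob (?E pi) = (p\<^sup>2 * increment tan pi (min \<theta> ?\<gamma>3) - q\<^sup>2 * increment cot ?\<gamma>3 (min \<theta> (3 * pi / 2)))
      / (2 * (lx * ly))"
  proof -
    have "increment tan 0 (min (\<theta> - pi) (?\<gamma>3 - pi)) = increment tan pi (min \<theta> ?\<gamma>3)"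
      using increment_cong_shift[of tan pi tan pi "min \<theta> ?\<gamma>3", OF tan_minus_pi]
      by (simp add: min_diff_distrib_left)
    moreover have "increment cot (?\<gamma>3 - pi) (min (\<theta> - pi) (pi / 2)) = increment cot ?\<gamma>3 (min \<theta> (3 * pi / 2))"
      using increment_cong_shift[of cot pi cot ?\<gamma>3 "min \<theta> (3 * pi / 2)", OF cot_minus_pi]
      by (simp add: min_diff_distrib_left)
    moreover have "prob (?E pi) = ((- p)\<^sup>2 * increment tan 0 (min (\<theta> - pi) (arctan (- q / - p)))
        - (- q)\<^sup>2 * increment cot (arctan (- q / - p)) (min (\<theta> - pi) (pi / 2)))
          / (2 * ((- p - - a) * (- q - - b)))"
    proof (rule prob_first_quadrant_sector[OF W2(2) _ W2(1) _ _ _ _ polar2])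
      show "- (3 * pi / 2) \<le> \<Theta> \<omega> - pi \<and> \<Theta> \<omega> - pi < 2 * pi" if "\<omega> \<in> space M" for \<omega>
        using range[OF that] pi_gt_zero by linarith
    qed (use pos in auto)
    ultimately show ?thesis
      using size by (simp only: g3) simp
  qed
  have P3: "prob (?E (3 * pi / 2)) =
      (- q\<^sup>2 * increment cot (3 * pi / 2) (min \<theta> ?\<gamma>4) + a\<^sup>2 * increment tan ?\<gamma>4 \<theta>) / (2 * (lx * ly))"
  proof -
    have "increment tan 0 (min (\<theta> - 3 * pi / 2) (?\<gamma>4 - 3 * pi / 2)) = - increment cot (3 * pi / 2) (min \<theta> ?\<gamma>4)"
      using increment_cong_shift[of tan "3 * pi / 2" "\<lambda>x. - cot x" "3 * pi / 2" "min \<theta> ?\<gamma>4", OF tan_minus_3pi_half]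
      by (simp add: increment_uminus min_diff_distrib_left)
    \<comment> \<open>By \<open>\<theta> \<le> 2 * pi\<close> the minimum is
      \<open>\<theta> - 3 * pi / 2\<close>, which is why the second summand has the bare upper bound
      \<open>\<theta>\<close>.\<close>
    moreover have "increment cot (?\<gamma>4 - 3 * pi / 2) (min (\<theta> - 3 * pi / 2) (pi / 2)) = - increment tan ?\<gamma>4 \<theta>"
      using increment_cong_shift[of cot "3 * pi / 2" "\<lambda>x. - tan x" ?\<gamma>4 \<theta>, OF cot_minus_3pi_half] assms(10)
      by (simp add: increment_uminus min_def)
    moreover have "prob (?E (3 * pi / 2)) = ((- q)\<^sup>2 * increment tan 0 (min (\<theta> - 3 * pi / 2) (arctan (a / - q)))
        - a\<^sup>2 * increment cot (arctan (a / - q)) (min (\<theta> - 3 * pi / 2) (pi / 2)))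
          / (2 * ((- q - - b) * (a - p)))"
    proof (rule prob_first_quadrant_sector[OF W3(2) _ W3(1) _ _ _ _ polar3])
      show "- (3 * pi / 2) \<le> \<Theta> \<omega> - 3 * pi / 2 \<and> \<Theta> \<omega> - 3 * pi / 2 < 2 * pi" if "\<omega> \<in> space M" for \<omega>
        using range[OF that] pi_gt_zero by linarith
    qed (use pos in auto)
    ultimately show ?thesis
      using size by (simp only: g4) (simp add: mult.commute)
  qed
  show ?thesis
    unfolding cdf P0 P1 P2 P3 sum_1_4 sum_5_8
    by (simp add: h_def eps_def Let_def apbq[symmetric] add_divide_distrib diff_divide_distrib algebra_simps)
qed

end
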